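(* Let $X$ be a finite nonempty set of keys, $\Sigma$ a set, $q\ge1$ an integer, $\epsilon\in[0,1)$, $k\ge3$ an integer, and let $\mathcal{H}=\{h_x:\Sigma\to[2^q]\}_{x\in X}$ be $(\epsilon,k)$-wise independent. Let $m=k-3$ and $\sigma:\{0,\dots,q-1\}\times\{0,\dots,m\}\to\Sigma$ be injective, and let $f$ be FlipHash as defined in the context with this $m$. Then $f$ is $O(\epsilon+2^{-k})$-regular: there is an absolute constant $C>0$ (independent of $\epsilon,k,q,n,z,X,\mathcal{H},\sigma$) such that for all $n\in\{1,\dots,2^q\}$ and all $z\in[n]$, $$\Big|\Pr_{x\in X}\big(f(x,n)=z\big)-\frac1n\Big|\le \frac{C\,(\epsilon+2^{-k})}{n},$$ where $x$ is drawn uniformly from $X$.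
   Context: $[N]=\{0,\dots,N-1\}$; $\oplus$ is bitwise XOR. $a\overset{\epsilon}{\approx}b$ means $b(1-\epsilon)\le a\le b(1+\epsilon)$. $\mathcal{H}$ is $(\epsilon,k)$-wise independent if for all pairwise distinct $\sigma_1,\dots,\sigma_k\in\Sigma$ and all $z_1,\dots,z_k\in[2^q]$, $\Pr_{x\in X}(\bigwedge_{i=1}^k h_x(\sigma_i)=z_i)\overset{\epsilon}{\approx}2^{-qk}$ with $x$ uniform in $X$. For $x\in X$, $r\in\{0,\dots,q\}$: $\tilde f(x,2^r)$ is computed as $a= h_x(\sigma(0,0))\bmod 2^r$; $b=\lfloor\log_2 a\rfloor$ if $a>0$, else $b=0$; $c=h_x(\sigma(b,0))\bmod 2^b$; $\tilde f(x,2^r)=a\oplus c$. For $n\in\{1,\dots,2^q\}$, FlipHash $f(x,n)\in[n]$ is computed as: let $r=\lceil\log_2 n\rceil$ and $d=\tilde f(x,2^r)$. If $d<n$, return $d$. Otherwise, for $i=1,\dots,m$ in order: let $e_i=h_x(\sigma(r-1,i))\bmod 2^r$; if $e_i<2^{r-1}$, return $\tilde f(x,2^{r-1})$; else if $e_i<n$, return $e_i$; else continue. If the loop finishes without returning, return $\tilde f(x,2^{r-1})$.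
   Formalization: For q = 1 the formal theorem also assumes that Σ has at least k elements; otherwise (ε,k)-wise independence is vacuous and the claim fails (h_x = 0, ε = 0, n = 2). C is stated for keys and hash inputs from fixed ambient types, which covers all cases by renaming. *)

theory Defs
  imports "HOL-Probability.Probability_Mass_Function"
begin

definition rel_approx :: "real \<Rightarrow> real \<Rightarrow> real \<Rightarrow> bool" where
  "rel_approx \<epsilon> a b \<longleftrightarrow> b * (1 - \<epsilon>) \<le> a \<and> a \<le> b * (1 + \<epsilon>)"

text \<open>The family is \<open>h x\<close> for \<open>x \<in> X\<close>, with domain \<open>S\<close> and codomain \<open>{..<2 ^ q}\<close>.
  Pitfall: the condition is vacuous if \<open>S\<close> has fewer than \<open>k\<close> elements.\<close>

definition k_wise_independent ::
  "real \<Rightarrow> nat \<Rightarrow> nat \<Rightarrow> 'x set \<Rightarrow> 's set \<Rightarrow> ('x \<Rightarrow> 's \<Rightarrow> nat) \<Rightarrow> bool" where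
  "k_wise_independent \<epsilon> k q X S h \<longleftrightarrow>
     (\<forall>s z. s \<in> {1..k} \<rightarrow> S \<and> inj_on s {1..k} \<and> z \<in> {1..k} \<rightarrow> {..<2 ^ q} \<longrightarrow>
        rel_approx \<epsilon>
          (measure_pmf.prob (pmf_of_set X) {x. \<forall>i\<in>{1..k}. h x (s i) = z i})
          (1 / 2 ^ (q * k)))"

text \<open>\<open>fliphash_pow2 h \<sigma> x r\<close> is the value of the power-of-two variant for \<open>2 ^ r\<close> buckets:
  the argument is the exponent.\<close>

definition fliphash_pow2 ::
  "('x \<Rightarrow> 's \<Rightarrow> nat) \<Rightarrow> (nat \<times> nat \<Rightarrow> 's) \<Rightarrow> 'x \<Rightarrow> nat \<Rightarrow> nat" where
  "fliphash_pow2 h \<sigma> x r =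
     (let a = h x (\<sigma> (0, 0)) mod 2 ^ r;
          b = (if a > 0 then nat \<lfloor>log 2 (real a)\<rfloor> else 0);
          c = h x (\<sigma> (b, 0)) mod 2 ^ b
      in xor a c)"

text \<open>The list argument holds the loop indices still to be visited.\<close>

fun fliphash_loop ::
  "('x \<Rightarrow> 's \<Rightarrow> nat) \<Rightarrow> (nat \<times> nat \<Rightarrow> 's) \<Rightarrow> 'x \<Rightarrow> nat \<Rightarrow> nat \<Rightarrow> nat list \<Rightarrow> nat" where
  "fliphash_loop h \<sigma> x n r [] = fliphash_pow2 h \<sigma> x (r - 1)"
| "fliphash_loop h \<sigma> x n r (i # is) =
     (let e = h x (\<sigma> (r - 1, i)) mod 2 ^ r
      in if e < 2 ^ (r - 1) then fliphash_pow2 h \<sigma> x (r - 1)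
         else if e < n then e
         else fliphash_loop h \<sigma> x n r is)"

text \<open>The truncated \<open>r - 1\<close> in the loop is harmless: for \<open>r = 0\<close>, i.e. \<open>n = 1\<close>, we have
  \<open>d = 0 < n\<close> and the loop is not entered.\<close>

definition fliphash ::
  "('x \<Rightarrow> 's \<Rightarrow> nat) \<Rightarrow> (nat \<times> nat \<Rightarrow> 's) \<Rightarrow> nat \<Rightarrow> 'x \<Rightarrow> nat \<Rightarrow> nat" where
  "fliphash h \<sigma> m x n =
     (let r = nat \<lceil>log 2 (real n)\<rceil>;
          d = fliphash_pow2 h \<sigma> x r
      in if d < n then d else fliphash_loop h \<sigma> x n r [1..<m + 1])"

end

theory Submission
  imports Defs
begin

text \<open>Once the value \<open>a\<close> of the key \<open>\<sigma> (0, 0)\<close> is fixed, the computation of \<open>f(x, n)\<close> reads at most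
  \<open>k - 1\<close> further hash values, so the event \<open>f(x, n) = z\<close> is a disjoint union of cylinders on at most
  \<open>k\<close> distinct keys. Relative approximation is preserved by disjoint unions; hence the probability
  is, up to a factor in \<open>[1 - \<epsilon>, 1 + \<epsilon>]\<close>, what it would be for fully independent uniform hashes.

  In that ideal case let \<open>2 ^ (r - 1) < n \<le> 2 ^ r\<close> and \<open>u = (2 ^ r - n) / 2 ^ r \<le> 1/2\<close>. The power-of-two
  variant is uniform, since \<open>a \<mapsto> a \<oplus> c\<close> permutes the dyadic block of \<open>a\<close>, and each round
  of the loop continues with probability \<open>u\<close>. Summing the geometric series shows that the
  probability of \<open>z\<close> differs from \<open>1/n\<close> by at most \<open>u ^ (m + 1) / n \<le> 4 * 2 ^ (- k) / n\<close>.\<close>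

section \<open>Leading bits, dyadic blocks and XOR\<close>

definition bin_log :: "nat \<Rightarrow> nat" where
  "bin_log a = (if a > 0 then nat \<lfloor>log 2 (real a)\<rfloor> else 0)"

text \<open>The orbit of \<open>z\<close> under XOR with all numbers below
  \<open>2 ^ bin_log z\<close>. The values 0 and 1 share \<open>bin_log\<close> 0 but form separate
  blocks, since XOR with 0 moves neither.\<close>

definition bin_block :: "nat \<Rightarrow> nat set" where
  "bin_block z = (if z = 0 then {0} else {2 ^ bin_log z..<2 ^ Suc (bin_log z)})"

lemma bin_log_eqI:
  assumes "2 ^ b \<le> a" "a < 2 ^ Suc b"
  shows "bin_log a = b"
proof -
  have "a > 0" using assms(1) by (metis less_le_trans zero_less_numeral zero_less_power)
  moreover have "\<lfloor>log 2 (real a)\<rfloor> = int b"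
    using floor_log_nat_eq_powr_iff[of 2 a b] assms \<open>a > 0\<close> by simp
  ultimately show ?thesis by (simp add: bin_log_def)
qed

lemma bin_log_bounds:
  assumes "a > 0"
  shows "2 ^ bin_log a \<le> a" "a < 2 ^ Suc (bin_log a)"
proof -
  obtain b where "2 ^ b \<le> a" "a < 2 ^ (b + 1)"
    using ex_power_ivl1[of 2 a] assms by auto
  moreover from this have "bin_log a = b" by (intro bin_log_eqI) auto
  ultimately show "2 ^ bin_log a \<le> a" "a < 2 ^ Suc (bin_log a)" by auto
qed

lemma bin_log_less:
  assumes "a < 2 ^ r" "r > 0"
  shows "bin_log a < r"
proof (cases "a = 0")
  case False
  then have "(2::nat) ^ bin_log a < 2 ^ r" using bin_log_bounds[of a] assms by linarith
  then show ?thesis by simp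
qed (use assms in \<open>simp add: bin_log_def\<close>)

lemma self_mem_bin_block: "z \<in> bin_block z"
  using bin_log_bounds[of z] by (auto simp: bin_block_def)

lemma bin_log_eq_if_mem_bin_block: "a \<in> bin_block z \<Longrightarrow> bin_log a = bin_log z"
  by (auto simp: bin_block_def split: if_splits intro: bin_log_eqI)

lemma bin_block_upper:
  assumes "z > 0" "2 ^ r \<le> z" "z < 2 ^ Suc r"
  shows "bin_block z = {2 ^ r..<2 ^ Suc r}"
  using bin_log_eqI[OF assms(2,3)] assms by (simp add: bin_block_def)

lemma finite_bin_block [simp]: "finite (bin_block z)"
  by (simp add: bin_block_def)

lemma card_bin_block: "card (bin_block z) = 2 ^ bin_log z"
  by (simp add: bin_block_def bin_log_def)

lemma bin_block_subset:
  assumes "z < 2 ^ r"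
  shows "bin_block z \<subseteq> {..<2 ^ r}"
proof (cases "z = 0")
  case False
  have "Suc (bin_log z) \<le> r"
    using bin_log_less[OF assms] assms False by (cases r) auto
  then have "(2::nat) ^ Suc (bin_log z) \<le> 2 ^ r" by (intro power_increasing) auto
  then show ?thesis using False unfolding bin_block_def by (auto intro: less_le_trans)
qed (auto simp: bin_block_def)

text \<open>For \<open>a > 0\<close>, a number \<open>c\<close> below the leading power of
  \<open>a\<close> cannot touch the leading bit: the quotient by \<open>2 ^ bin_log a\<close> stays
  1.\<close>

lemma xor_mem_bin_block:
  assumes "c < 2 ^ bin_log a"
  shows "xor a c \<in> bin_block a"
proof (cases "a = 0")
  case False
  define b where "b = bin_log a"
  have "2 ^ b \<le> a" "a < 2 * 2 ^ b" using bin_log_bounds[of a] False by (auto simp: b_def)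
  then have "a div 2 ^ b = 1" by (intro div_nat_eqI) auto
  moreover have "c div 2 ^ b = 0" using assms by (simp add: b_def)
  ultimately have "xor a c div 2 ^ b = 1"
    using drop_bit_xor[of b a c] by (simp add: drop_bit_eq_div)
  then have "2 ^ b \<le> xor a c" "xor a c < 2 * 2 ^ b"
    by (metis div_less linorder_not_le zero_neq_one,
        metis Suc_1 less_Suc_eq less_mult_imp_div_less div_less_iff_less_mult mult.commute lessI
          One_nat_def zero_less_power zero_less_numeral)
  then show ?thesis using False by (simp add: bin_block_def b_def)
qed (use assms in \<open>simp add: bin_block_def bin_log_def\<close>)

text \<open>Equal leading bits cancel. Hence every \<open>a\<close> in the block of \<open>z\<close>
  reaches \<open>z\<close> through exactly one admissible \<open>c\<close>, namely
  \<open>xor a z\<close>.\<close>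

lemma xor_less_if_mem_bin_block:
  assumes "a \<in> bin_block z"
  shows "xor a z < 2 ^ bin_log z"
proof (cases "z = 0")
  case False
  define b where "b = bin_log z"
  have *: "v div 2 ^ b = 1" if "v \<in> bin_block z" for v
    using that False by (intro div_nat_eqI) (auto simp: bin_block_def b_def)
  have "xor a z div 2 ^ b = 0"
    using drop_bit_xor[of b a z] *[OF assms] *[OF self_mem_bin_block]
    by (simp add: drop_bit_eq_div)
  then show ?thesis
    by (metis b_def div_eq_0_iff power_not_zero zero_neq_numeral)
qed (use assms in \<open>simp add: bin_block_def bin_log_def\<close>)

text \<open>XOR with \<open>a\<close> is an involution, so \<open>c\<close> must be
  \<open>xor a z\<close>; and \<open>a\<close> shares the block of \<open>z\<close>, so the second
  key can be named through \<open>z\<close> instead of the random \<open>a\<close>. Only with keys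
  fixed in this way can the event be split into cylinders.\<close>

lemma fliphash_pow2_eq_iff:
  "fliphash_pow2 h \<sigma> x r = z \<longleftrightarrow>
     h x (\<sigma> (0, 0)) mod 2 ^ r \<in> bin_block z \<and>
     h x (\<sigma> (bin_log z, 0)) mod 2 ^ bin_log z = xor (h x (\<sigma> (0, 0)) mod 2 ^ r) z"
    (is "?L \<longleftrightarrow> ?R")
proof -
  define a where "a = h x (\<sigma> (0, 0)) mod 2 ^ r"
  define c where "c = h x (\<sigma> (bin_log a, 0)) mod 2 ^ bin_log a"
  have eq: "fliphash_pow2 h \<sigma> x r = xor a c"
    by (simp add: fliphash_pow2_def a_def c_def bin_log_def Let_def)
  show ?thesis
  proof
    assume ?L
    then have z: "z = xor a c" using eq by simp
    have "z \<in> bin_block a" unfolding z by (rule xor_mem_bin_block) (simp add: c_def)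
    then have log: "bin_log z = bin_log a" by (rule bin_log_eq_if_mem_bin_block)
    have "a \<in> bin_block z"
      using \<open>z \<in> bin_block a\<close> log self_mem_bin_block[of a]
      by (auto simp: bin_block_def split: if_splits)
    moreover have "c = xor a z" by (simp add: z flip: xor.assoc)
    ultimately show ?R using log by (simp add: a_def c_def)
  next
    assume ?R
    then have "a \<in> bin_block z" and c: "h x (\<sigma> (bin_log z, 0)) mod 2 ^ bin_log z = xor a z"
      by (auto simp: a_def)
    then have "bin_log a = bin_log z" by (intro bin_log_eq_if_mem_bin_block)
    then have "c = xor a z" using c by (simp add: c_def)
    then show ?L using eq by (simp flip: xor.assoc)
  qed
qed

lemma fliphash_pow2_less: "fliphash_pow2 h \<sigma> x r < 2 ^ r"
proof -
  define a where "a = h x (\<sigma> (0, 0)) mod 2 ^ r"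
  have "fliphash_pow2 h \<sigma> x r \<in> bin_block a"
    unfolding fliphash_pow2_def Let_def a_def[symmetric] bin_log_def[symmetric]
    by (rule xor_mem_bin_block) simp
  moreover have "bin_block a \<subseteq> {..<2 ^ r}" by (rule bin_block_subset) (simp add: a_def)
  ultimately show ?thesis by auto
qed

section \<open>Residue counts and approximate probabilities of cylinders\<close>

lemma card_residues:
  assumes "r \<le> q" "T \<subseteq> {..<2 ^ r}"
  shows "card {v. v < (2::nat) ^ q \<and> v mod 2 ^ r \<in> T} = card T * 2 ^ (q - r)"
proof -
  have q: "(2::nat) ^ q = 2 ^ r * 2 ^ (q - r)" using assms(1) by (simp flip: power_add)
  \<comment> \<open>Division with remainder by \<open>2 ^ r\<close>: the remainder ranges over
    \<open>T\<close>, the quotient freely below \<open>2 ^ (q - r)\<close>.\<close>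
  have "bij_betw (\<lambda>(t, w). t + 2 ^ r * w) (T \<times> {..<2 ^ (q - r)})
          {v. v < 2 ^ q \<and> v mod 2 ^ r \<in> T}"
  proof (rule bij_betw_byWitness[where f' = "\<lambda>v. (v mod 2 ^ r, v div 2 ^ r)"])
    show "\<forall>a\<in>T \<times> {..<2 ^ (q - r)}.
        (\<lambda>v. (v mod 2 ^ r, v div 2 ^ r)) ((\<lambda>(t, w). t + 2 ^ r * w) a) = a"
      using assms(2) by auto
    show "(\<lambda>(t, w). t + 2 ^ r * w) ` (T \<times> {..<2 ^ (q - r)}) \<subseteq> {v. v < 2 ^ q \<and> v mod 2 ^ r \<in> T}"
    proof (clarsimp, intro conjI)
      fix t w :: nat assume tw: "t \<in> T" "w < 2 ^ (q - r)"
      then have t: "t < 2 ^ r" using assms(2) by auto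
      have "t + 2 ^ r * w < 2 ^ r * Suc w" using t by simp
      also have "\<dots> \<le> 2 ^ r * 2 ^ (q - r)" using tw by (intro mult_le_mono) auto
      finally show "t + 2 ^ r * w < 2 ^ q" by (simp add: q)
      show "t mod 2 ^ r \<in> T" using t tw by simp
    qed
    show "(\<lambda>v. (v mod 2 ^ r, v div 2 ^ r)) ` {v. v < 2 ^ q \<and> v mod 2 ^ r \<in> T} \<subseteq> T \<times> {..<2 ^ (q - r)}"
      by (auto simp: q less_mult_imp_div_less mult.commute)
  qed auto
  then have "card (T \<times> {..<(2::nat) ^ (q - r)}) = card {v. v < (2::nat) ^ q \<and> v mod 2 ^ r \<in> T}"
    by (rule bij_betw_same_card)
  then show ?thesis by (simp add: card_cartesian_product)
qed

text \<open>The assumption \<open>enough_keys\<close> keeps independence from being vacuous and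
  supplies fresh keys for padding short cylinders to length \<open>k\<close>.\<close>

locale approx_independent_family =
  fixes \<epsilon> :: real and k q :: nat and X :: "'x set" and S :: "'s set" and h :: "'x \<Rightarrow> 's \<Rightarrow> nat"
  assumes finite_X: "finite X" and X_nonempty: "X \<noteq> {}"
    and enough_keys: "infinite S \<or> k \<le> card S"
    and h_range: "\<And>x. x \<in> X \<Longrightarrow> h x \<in> S \<rightarrow> {..<2 ^ q}"
    and independent: "k_wise_independent \<epsilon> k q X S h"
begin

definition approx_prob :: "('x \<Rightarrow> bool) \<Rightarrow> real \<Rightarrow> bool" where
  "approx_prob P p \<longleftrightarrow> rel_approx \<epsilon> (measure_pmf.prob (pmf_of_set X) {x. P x}) p"

lemma prob_eq: "measure_pmf.prob (pmf_of_set X) {x. P x} = card {x \<in> X. P x} / card X"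
  using measure_pmf_of_set[OF X_nonempty finite_X, of "{x. P x}"] by (simp add: Int_def)

lemma approx_prob_cong:
  assumes "approx_prob P p" "\<And>x. x \<in> X \<Longrightarrow> P x \<longleftrightarrow> Q x"
  shows "approx_prob Q p"
proof -
  have "{x \<in> X. P x} = {x \<in> X. Q x}" using assms(2) by auto
  then show ?thesis using assms(1) by (simp add: approx_prob_def prob_eq)
qed

lemma approx_prob_False: "approx_prob (\<lambda>_. False) 0"
  by (simp add: approx_prob_def rel_approx_def)

text \<open>Both bounds of \<open>rel_approx\<close> are linear, so for disjoint events they add up
  with the same \<epsilon>: the relative error does not grow with the number of pieces.\<close>

lemma approx_prob_disj:
  assumes "approx_prob P p" "approx_prob Q p'" "\<And>x. x \<in> X \<Longrightarrow> P x \<Longrightarrow> Q x \<Longrightarrow> False"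
  shows "approx_prob (\<lambda>x. P x \<or> Q x) (p + p')"
proof -
  have "{x \<in> X. P x \<or> Q x} = {x \<in> X. P x} \<union> {x \<in> X. Q x}" by auto
  moreover have "{x \<in> X. P x} \<inter> {x \<in> X. Q x} = {}" using assms(3) by auto
  ultimately have "card {x \<in> X. P x \<or> Q x} = card {x \<in> X. P x} + card {x \<in> X. Q x}"
    using finite_X by (simp add: card_Un_disjoint)
  then have "measure_pmf.prob (pmf_of_set X) {x. P x \<or> Q x} =
    measure_pmf.prob (pmf_of_set X) {x. P x} + measure_pmf.prob (pmf_of_set X) {x. Q x}"
    unfolding prob_eq by (simp add: add_divide_distrib)
  then show ?thesis
    using assms(1,2) by (simp add: approx_prob_def rel_approx_def distrib_right)
qed

lemma approx_prob_Bex: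
  assumes "finite I" "\<And>i. i \<in> I \<Longrightarrow> approx_prob (P i) (p i)"
    "\<And>i j x. i \<in> I \<Longrightarrow> j \<in> I \<Longrightarrow> x \<in> X \<Longrightarrow> P i x \<Longrightarrow> P j x \<Longrightarrow> i = j"
  shows "approx_prob (\<lambda>x. \<exists>i\<in>I. P i x) (\<Sum>i\<in>I. p i)"
  using assms
proof (induction I rule: finite_induct)
  case empty
  then show ?case by (simp add: approx_prob_False)
next
  case (insert i I)
  have "approx_prob (\<lambda>x. P i x \<or> (\<exists>j\<in>I. P j x)) (p i + (\<Sum>j\<in>I. p j))"
  proof (rule approx_prob_disj)
    show "approx_prob (\<lambda>x. \<exists>j\<in>I. P j x) (\<Sum>j\<in>I. p j)"
      using insert.prems by (intro insert.IH) auto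
    fix x assume "x \<in> X" "P i x" "\<exists>j\<in>I. P j x"
    then show False using insert.prems(2)[of i] insert.hyps by blast
  qed (use insert.prems in auto)
  then show ?case using insert.hyps by simp
qed

definition cylinder :: "('s \<times> nat set) list \<Rightarrow> 'x \<Rightarrow> bool" where
  "cylinder L x \<longleftrightarrow> (\<forall>(y, V)\<in>set L. h x y \<in> V)"

text \<open>For distinct keys this is the probability of the cylinder under independent uniform
  hashes.\<close>

definition weight :: "('s \<times> nat set) list \<Rightarrow> real" where
  "weight L = (\<Prod>(y, V)\<leftarrow>L. card V / 2 ^ q)"

definition admissible :: "('s \<times> nat set) list \<Rightarrow> bool" where
  "admissible L \<longleftrightarrow> distinct (map fst L) \<and> length L \<le> k \<and>
     (\<forall>(y, V)\<in>set L. y \<in> S \<and> V \<subseteq> {..<2 ^ q})"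

lemma cylinder_simps [simp]:
  "cylinder [] x \<longleftrightarrow> True"
  "cylinder ((y, V) # L) x \<longleftrightarrow> h x y \<in> V \<and> cylinder L x"
  "cylinder (L @ L') x \<longleftrightarrow> cylinder L x \<and> cylinder L' x"
  by (auto simp: cylinder_def)

lemma weight_simps [simp]:
  "weight [] = 1"
  "weight ((y, V) # L) = card V / 2 ^ q * weight L"
  "weight (L @ L') = weight L * weight L'"
  by (auto simp: weight_def)

lemma approx_prob_points:
  assumes "distinct (map fst ps)" "length ps = k" "\<forall>(y, v)\<in>set ps. y \<in> S \<and> v < 2 ^ q"
  shows "approx_prob (\<lambda>x. \<forall>(y, v)\<in>set ps. h x y = v) (1 / 2 ^ (q * k))"
proof -
  \<comment> \<open>The shift translates list positions, counted from 0, into the indices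
    \<open>{1..k}\<close> of \<open>k_wise_independent\<close>.\<close>
  define s where "s i = fst (ps ! (i - 1))" for i
  define z where "z i = snd (ps ! (i - 1))" for i
  have mem: "ps ! (i - 1) \<in> set ps" if "i \<in> {1..k}" for i
    using that assms(2) by (intro nth_mem) auto
  have "s \<in> {1..k} \<rightarrow> S" "z \<in> {1..k} \<rightarrow> {..<2 ^ q}"
    using mem assms(3) by (fastforce simp: s_def z_def split_beta)+
  moreover have "inj_on s {1..k}"
  proof (rule inj_onI)
    fix i j assume ij: "i \<in> {1..k}" "j \<in> {1..k}" "s i = s j"
    have "i - 1 < length (map fst ps)" "j - 1 < length (map fst ps)"
      using ij assms(2) by auto
    moreover from this have "map fst ps ! (i - 1) = map fst ps ! (j - 1)"
      using ij(3) by (simp add: s_def)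
    ultimately have "i - 1 = j - 1"
      using nth_eq_iff_index_eq[OF assms(1)] by blast
    then show "i = j" using ij by auto
  qed
  moreover have "(\<forall>(y, v)\<in>set ps. h x y = v) \<longleftrightarrow> (\<forall>i\<in>{1..k}. h x (s i) = z i)" for x
  proof
    assume "\<forall>(y, v)\<in>set ps. h x y = v"
    then show "\<forall>i\<in>{1..k}. h x (s i) = z i" using mem by (fastforce simp: s_def z_def split_beta)
  next
    assume *: "\<forall>i\<in>{1..k}. h x (s i) = z i"
    show "\<forall>(y, v)\<in>set ps. h x y = v"
    proof clarify
      fix y v assume "(y, v) \<in> set ps"
      then obtain i where "i < k" "ps ! i = (y, v)" using assms(2) by (auto simp: in_set_conv_nth)
      then show "h x y = v" using *[rule_format, of "Suc i"] by (simp add: s_def z_def)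
    qed
  qed
  ultimately show ?thesis
    using independent unfolding k_wise_independent_def approx_prob_def by simp
qed

text \<open>Constraints move one at a time from \<open>L\<close> to \<open>ps\<close> by splitting
  over the single values in \<open>V\<close>. The total number of keys stays \<open>k\<close>, and
  summing over \<open>V\<close> yields the factor \<open>card V / 2 ^ q\<close>.\<close>

lemma approx_prob_cylinder_points:
  assumes "distinct (map fst L @ map fst ps)" "length L + length ps = k"
    "\<forall>(y, V)\<in>set L. y \<in> S \<and> V \<subseteq> {..<2 ^ q}" "\<forall>(y, v)\<in>set ps. y \<in> S \<and> v < 2 ^ q"
  shows "approx_prob (\<lambda>x. cylinder L x \<and> (\<forall>(y, v)\<in>set ps. h x y = v))
    (weight L / 2 ^ (q * length ps))"
  using assms
proof (induction L arbitrary: ps)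
  case Nil
  then show ?case using approx_prob_points[of ps] by simp
next
  case (Cons yV L)
  obtain y V where yV: "yV = (y, V)" by (cases yV)
  have V: "finite V" using Cons.prems(3) yV finite_subset by fastforce
  have "approx_prob (\<lambda>x. \<exists>v\<in>V. cylinder L x \<and> (\<forall>(y, v)\<in>set ((y, v) # ps). h x y = v))
    (\<Sum>v\<in>V. weight L / 2 ^ (q * Suc (length ps)))"
  proof (rule approx_prob_Bex[OF V])
    fix v assume "v \<in> V"
    then show "approx_prob (\<lambda>x. cylinder L x \<and> (\<forall>(y, v)\<in>set ((y, v) # ps). h x y = v))
        (weight L / 2 ^ (q * Suc (length ps)))"
      using Cons.IH[of "(y, v) # ps"] Cons.prems yV by auto
  qed auto
  also have "(\<Sum>v\<in>V. weight L / 2 ^ (q * Suc (length ps))) = weight (yV # L) / 2 ^ (q * length ps)"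
    by (simp add: yV power_add)
  also have "(\<lambda>x. \<exists>v\<in>V. cylinder L x \<and> (\<forall>(y, v)\<in>set ((y, v) # ps). h x y = v)) =
    (\<lambda>x. cylinder (yV # L) x \<and> (\<forall>(y, v)\<in>set ps. h x y = v))"
    by (auto simp: yV)
  finally show ?case .
qed

text \<open>Short cylinders are padded with unconstrained fresh keys up to length \<open>k\<close>.\<close>

lemma approx_prob_cylinder:
  assumes "admissible L"
  shows "approx_prob (cylinder L) (weight L)"
  using assms
proof (induction "k - length L" arbitrary: L)
  case 0
  then show ?case using approx_prob_cylinder_points[of L "[]"] by (simp add: admissible_def)
next
  case (Suc j)
  have "\<not> S \<subseteq> fst ` set L"
  proof
    assume sub: "S \<subseteq> fst ` set L"
    then have "finite S" by (rule finite_subset) simp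
    moreover have "card S \<le> card (fst ` set L)" using sub by (intro card_mono) auto
    moreover have "card (fst ` set L) \<le> length L"
      by (metis card_length length_map set_map)
    ultimately show False using enough_keys Suc.hyps(2) by linarith
  qed
  then obtain y where y: "y \<in> S" "y \<notin> fst ` set L" by auto
  have "approx_prob (cylinder ((y, {..<2 ^ q}) # L)) (weight ((y, {..<2 ^ q}) # L))"
    using Suc.hyps(2) Suc.prems y by (intro Suc.hyps(1)) (auto simp: admissible_def)
  moreover have "weight ((y, {..<2 ^ q}) # L) = weight L" by simp
  moreover have "cylinder ((y, {..<2 ^ q}) # L) x \<longleftrightarrow> cylinder L x" if "x \<in> X" for x
    using h_range[OF that] y(1) by auto
  ultimately show ?case by (metis approx_prob_cong)
qed

text \<open>Encodes a condition on a reduced hash as a set of full hash values, the form of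
  constraint that a cylinder takes.\<close>

definition residues :: "nat \<Rightarrow> nat set \<Rightarrow> nat set" where
  "residues r T = {v. v < 2 ^ q \<and> v mod 2 ^ r \<in> T}"

lemma residues_subset: "residues r T \<subseteq> {..<2 ^ q}"
  by (auto simp: residues_def)

lemma residues_density:
  assumes "r \<le> q" "T \<subseteq> {..<2 ^ r}"
  shows "card (residues r T) / 2 ^ q = card T / 2 ^ r"
proof -
  have "(2::real) ^ q = 2 ^ r * 2 ^ (q - r)" using assms(1) by (simp flip: power_add)
  then show ?thesis by (simp add: residues_def card_residues[OF assms])
qed

lemma hash_mem_residues_iff:
  "x \<in> X \<Longrightarrow> y \<in> S \<Longrightarrow> h x y \<in> residues r T \<longleftrightarrow> h x y mod 2 ^ r \<in> T"
  using h_range by (auto simp: residues_def)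

end

section \<open>Exits of the loop and their ideal probabilities\<close>

lemma fliphash_loop_eq_pow2:
  assumes "n \<ge> 2 ^ (r - 1)" "fliphash_loop h \<sigma> x n r is < 2 ^ (r - 1)"
  shows "fliphash_loop h \<sigma> x n r is = fliphash_pow2 h \<sigma> x (r - 1)"
  using assms by (induction "is") (auto simp: Let_def split: if_splits)

text \<open>The probability that the loop returns \<open>z\<close> after at most \<open>j\<close> rounds, for independent
  uniform hashes; for \<open>z < 2 ^ (r - 1)\<close> this is conditional on \<open>fliphash_pow2 h \<sigma> x (r - 1) = z\<close>.\<close>

fun exit_prob :: "nat \<Rightarrow> nat \<Rightarrow> nat \<Rightarrow> nat \<Rightarrow> real" where
  "exit_prob r n z 0 = (if z < 2 ^ (r - 1) then 1 else 0)"
| "exit_prob r n z (Suc j) = (if z < 2 ^ (r - 1) then 1 / 2 else 1 / 2 ^ r) +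
     (2 ^ r - real n) / 2 ^ r * exit_prob r n z j"

text \<open>Solves an affine recurrence. With \<open>u = (2 ^ r - n) / 2 ^ r\<close> its fixed point
  is \<open>2 ^ (r - 1) / n\<close> in the lower half and \<open>1 / n\<close> in the upper half,
  and the distance to it shrinks by the factor \<open>u\<close> per round.\<close>

lemma exit_prob_closed_form:
  assumes "r > 0" "n > 0"
  shows "exit_prob r n z j =
    (if z < 2 ^ (r - 1)
     then 2 ^ (r - 1) / n + (n - 2 ^ (r - 1)) / n * ((2 ^ r - real n) / 2 ^ r) ^ j
     else (1 - ((2 ^ r - real n) / 2 ^ r) ^ j) / n)"
proof (induction j)
  case 0
  then show ?case using assms by (auto simp: field_simps)
next
  case (Suc j)
  obtain t where t: "r = Suc t" using assms(1) by (cases r) auto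
  define M :: real where "M = 2 ^ t"
  define w where "w = ((2 * M - real n) / (2 * M)) ^ j"
  have "M > 0" by (simp add: M_def)
  then show ?case using Suc assms(2)
    by (auto simp: t w_def[symmetric] M_def[symmetric] field_simps)
qed

section \<open>FlipHash events as disjoint unions of cylinders\<close>

locale fliphash_family = approx_independent_family \<epsilon> k q X S h
  for \<epsilon> :: real and k q :: nat and X :: "'x set" and S :: "'s set" and h :: "'x \<Rightarrow> 's \<Rightarrow> nat" +
  fixes \<sigma> :: "nat \<times> nat \<Rightarrow> 's" and m :: nat
  assumes eps_nonneg: "0 \<le> \<epsilon>" and q_pos: "q \<ge> 1" and k_eq: "k = m + 3"
    and \<sigma>_range: "\<sigma> \<in> {0..q - 1} \<times> {0..m} \<rightarrow> S" and \<sigma>_inj: "inj_on \<sigma> ({0..q - 1} \<times> {0..m})"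
begin

lemma \<sigma>_mem: "i < q \<Longrightarrow> j \<le> m \<Longrightarrow> \<sigma> (i, j) \<in> S"
  using \<sigma>_range by auto

lemma \<sigma>_eq_iff:
  "i < q \<Longrightarrow> j \<le> m \<Longrightarrow> i' < q \<Longrightarrow> j' \<le> m \<Longrightarrow> \<sigma> (i, j) = \<sigma> (i', j') \<longleftrightarrow> i = i' \<and> j = j'"
  using inj_on_eq_iff[OF \<sigma>_inj, of "(i, j)" "(i', j')"] by auto

text \<open>Here \<open>L\<close> collects the constraints on the keys read so far, and each round
  adds one fresh key. For \<open>z\<close> in the lower half, \<open>L\<close> must already force
  the fallback value to be \<open>z\<close>, so that leaving through the fallback reads nothing
  new.\<close>

lemma approx_prob_loop:
  assumes r: "1 \<le> r" "r \<le> q" and n: "2 ^ (r - 1) \<le> n" "n \<le> 2 ^ r" and z: "z < n"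
    and "distinct is" "set is \<subseteq> {1..m}" "admissible L" "length L + length is \<le> k"
    and "\<And>i. i \<in> set is \<Longrightarrow> \<sigma> (r - 1, i) \<notin> fst ` set L"
    and "\<And>x. x \<in> X \<Longrightarrow> z < 2 ^ (r - 1) \<Longrightarrow> cylinder L x \<Longrightarrow> fliphash_pow2 h \<sigma> x (r - 1) = z"
  shows "approx_prob (\<lambda>x. cylinder L x \<and> fliphash_loop h \<sigma> x n r is = z)
    (weight L * exit_prob r n z (length is))"
  using assms(6-)
proof (induction "is" arbitrary: L)
  case Nil
  show ?case
  proof (cases "z < 2 ^ (r - 1)")
    case True
    have "approx_prob (\<lambda>x. cylinder L x \<and> fliphash_loop h \<sigma> x n r [] = z) (weight L)"
      by (rule approx_prob_cong[OF approx_prob_cylinder[OF Nil(3)]]) (use Nil True in auto)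
    then show ?thesis using True by simp
  next
    case False
    then have "fliphash_pow2 h \<sigma> x (r - 1) \<noteq> z" for x
      using fliphash_pow2_less[of h \<sigma> x "r - 1"] by auto
    then show ?thesis using False approx_prob_False by simp
  qed
next
  case (Cons i "is")
  define y where "y = \<sigma> (r - 1, i)"
  \<comment> \<open>The values of \<open>e\<close> that end this round with result \<open>z\<close>:
    the whole lower half if \<open>L\<close> forces the fallback to be \<open>z\<close>, otherwise
    \<open>z\<close> alone. The values from \<open>n\<close> on continue the loop and are recorded
    in \<open>L2\<close>.\<close>
  define E where "E = (if z < 2 ^ (r - 1) then {..<2 ^ (r - 1)} else {z})"
  define L1 where "L1 = (y, residues r E) # L"
  define L2 where "L2 = (y, residues r {n..<2 ^ r}) # L"
  have y: "y \<in> S" using Cons.prems(2) r by (auto simp: y_def intro!: \<sigma>_mem)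
  have r2: "(2::nat) ^ r = 2 * 2 ^ (r - 1)" using r by (cases r) auto
  have r2': "(2::real) ^ r = 2 * 2 ^ (r - 1)" using r by (cases r) auto
  have E: "E \<subseteq> {..<2 ^ r}" using z n r2 by (auto simp: E_def)
  have adm: "admissible L1" "admissible L2"
    using Cons.prems y residues_subset by (auto simp: admissible_def L1_def L2_def y_def)
  have fresh: "\<sigma> (r - 1, j) \<notin> fst ` set L2" if "j \<in> set is" for j
  proof -
    have "\<sigma> (r - 1, j) \<noteq> y"
      using that Cons.prems(1,2) r by (auto simp: y_def \<sigma>_eq_iff)
    then show ?thesis using Cons.prems(5)[of j] that by (simp add: L2_def)
  qed
  have "approx_prob (\<lambda>x. cylinder L1 x \<or> (cylinder L2 x \<and> fliphash_loop h \<sigma> x n r is = z))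
    (weight L1 + weight L2 * exit_prob r n z (length is))"
  proof (rule approx_prob_disj)
    show "approx_prob (cylinder L1) (weight L1)" by (rule approx_prob_cylinder[OF adm(1)])
    show "approx_prob (\<lambda>x. cylinder L2 x \<and> fliphash_loop h \<sigma> x n r is = z)
        (weight L2 * exit_prob r n z (length is))"
    proof (rule Cons.IH)
      show "fliphash_pow2 h \<sigma> x (r - 1) = z"
        if "x \<in> X" "z < 2 ^ (r - 1)" "cylinder L2 x" for x
        using that Cons.prems(6)[of x] by (simp add: L2_def)
    qed (use Cons.prems adm fresh in \<open>auto simp: L2_def\<close>)
    show False if "cylinder L1 x" "cylinder L2 x \<and> fliphash_loop h \<sigma> x n r is = z" for x
      using that n z by (auto simp: L1_def L2_def residues_def E_def split: if_splits)
  qed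
  also have "weight L1 = (if z < 2 ^ (r - 1) then 1 / 2 else 1 / 2 ^ r) * weight L"
    using E r r2' by (simp add: L1_def residues_density) (auto simp: E_def)
  also have "weight L2 = (2 ^ r - real n) / 2 ^ r * weight L"
  proof -
    have "{n..<2 ^ r} \<subseteq> {..<2 ^ r}" by auto
    from residues_density[OF r(2) this] show ?thesis
      using n by (simp add: L2_def of_nat_diff)
  qed
  also have "(if z < 2 ^ (r - 1) then 1 / 2 else 1 / 2 ^ r) * weight L +
      (2 ^ r - real n) / 2 ^ r * weight L * exit_prob r n z (length is) =
      weight L * exit_prob r n z (length (i # is))"
    by (simp add: distrib_left mult_ac)
  finally have *: "approx_prob
    (\<lambda>x. cylinder L1 x \<or> (cylinder L2 x \<and> fliphash_loop h \<sigma> x n r is = z))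
    (weight L * exit_prob r n z (length (i # is)))" .
  have "cylinder L1 x \<or> (cylinder L2 x \<and> fliphash_loop h \<sigma> x n r is = z) \<longleftrightarrow>
      cylinder L x \<and> fliphash_loop h \<sigma> x n r (i # is) = z" if x: "x \<in> X" for x
  proof (cases "cylinder L x")
    case True
    define e where "e = h x y mod 2 ^ r"
    have "e < 2 ^ r" by (simp add: e_def)
    have "cylinder L1 x \<longleftrightarrow> e \<in> E" "cylinder L2 x \<longleftrightarrow> n \<le> e"
      using True x y \<open>e < 2 ^ r\<close> by (auto simp: L1_def L2_def hash_mem_residues_iff e_def)
    moreover have "fliphash_loop h \<sigma> x n r (i # is) =
      (if e < 2 ^ (r - 1) then fliphash_pow2 h \<sigma> x (r - 1)
       else if e < n then e else fliphash_loop h \<sigma> x n r is)"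
      by (simp add: e_def y_def Let_def)
    moreover have "fliphash_pow2 h \<sigma> x (r - 1) = z \<longleftrightarrow> z < 2 ^ (r - 1)"
      using Cons.prems(6)[OF x _ True] fliphash_pow2_less[of h \<sigma> x "r - 1"] by auto
    ultimately show ?thesis using True n z by (auto simp: E_def)
  qed (simp add: L1_def L2_def)
  then show ?case by (rule approx_prob_cong[OF *])
qed

text \<open>Each \<open>a\<close> in the block of \<open>z\<close> works with exactly one residue of
  the second hash; \<open>2 ^ b\<close> choices of weight \<open>1 / 2 ^ r / 2 ^ b\<close> add up to
  \<open>1 / 2 ^ r\<close>.\<close>

lemma approx_prob_pow2:
  assumes "r \<le> q" "z < 2 ^ r"
  shows "approx_prob (\<lambda>x. fliphash_pow2 h \<sigma> x r = z) (1 / 2 ^ r)"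
proof -
  define b where "b = bin_log z"
  \<comment> \<open>If \<open>b = 0\<close>, the second key is \<open>\<sigma> (0, 0)\<close>
    itself, and a residue modulo 1 says nothing; omitting it keeps the keys distinct.\<close>
  define L where "L a = (\<sigma> (0, 0), residues r {a}) #
    (if b = 0 then [] else [(\<sigma> (b, 0), residues b {xor a z})])" for a
  have b: "b < q"
    using bin_log_less[of z q] q_pos less_le_trans[OF assms(2) power_increasing[OF assms(1)]]
    by (simp add: b_def)
  have xor: "xor a z < 2 ^ b" if "a \<in> bin_block z" for a
    using xor_less_if_mem_bin_block[OF that] by (simp add: b_def)
  have "approx_prob (\<lambda>x. \<exists>a\<in>bin_block z. cylinder (L a) x) (\<Sum>a\<in>bin_block z. 1 / 2 ^ r / 2 ^ b)"
  proof (rule approx_prob_Bex)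
    fix a assume a: "a \<in> bin_block z"
    have "a < 2 ^ r" using a bin_block_subset[OF assms(2)] by auto
    then have "weight (L a) = 1 / 2 ^ r / 2 ^ b"
      using xor[OF a] assms(1) b by (simp add: L_def residues_density)
    moreover have "admissible (L a)"
      unfolding admissible_def using b residues_subset by (auto simp: L_def k_eq \<sigma>_mem \<sigma>_eq_iff)
    ultimately show "approx_prob (cylinder (L a)) (1 / 2 ^ r / 2 ^ b)"
      using approx_prob_cylinder by metis
  next
    show "a = a'" if "cylinder (L a) x" "cylinder (L a') x" for a a' x
      using that by (auto simp: L_def residues_def)
  qed simp
  also have "(\<Sum>a\<in>bin_block z. 1 / 2 ^ r / 2 ^ b) = (1 / 2 ^ r :: real)"
    by (simp add: card_bin_block b_def)
  finally have *: "approx_prob (\<lambda>x. \<exists>a\<in>bin_block z. cylinder (L a) x) (1 / 2 ^ r)" .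
  have "(\<exists>a\<in>bin_block z. cylinder (L a) x) \<longleftrightarrow> fliphash_pow2 h \<sigma> x r = z" if x: "x \<in> X" for x
  proof -
    have "cylinder (L a) x \<longleftrightarrow> h x (\<sigma> (0, 0)) mod 2 ^ r = a \<and> h x (\<sigma> (b, 0)) mod 2 ^ b = xor a z"
      if "a \<in> bin_block z" for a
      using x b xor[OF that] by (auto simp: L_def hash_mem_residues_iff \<sigma>_mem)
    then show ?thesis unfolding fliphash_pow2_eq_iff b_def by auto
  qed
  then show ?thesis by (rule approx_prob_cong[OF *])
qed

text \<open>The upper half is a single block, so all \<open>d\<close> in it share the second key
  \<open>\<sigma> (t, 0)\<close>.\<close>

lemma fliphash_pow2_upper_iff:
  assumes "2 ^ t \<le> d" "d < 2 ^ Suc t"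
  shows "fliphash_pow2 h \<sigma> x (Suc t) = d \<longleftrightarrow>
    2 ^ t \<le> h x (\<sigma> (0, 0)) mod 2 ^ Suc t \<and>
    h x (\<sigma> (t, 0)) mod 2 ^ t = xor (h x (\<sigma> (0, 0)) mod 2 ^ Suc t) d"
proof -
  have "d > 0" using assms(1) by (metis less_le_trans zero_less_numeral zero_less_power)
  then show ?thesis
    using bin_block_upper[OF _ assms] bin_log_eqI[OF assms]
    by (simp add: fliphash_pow2_eq_iff)
qed

lemma upper_xor_less:
  fixes a d :: nat
  assumes "2 ^ t \<le> d" "d < 2 ^ Suc t" "2 ^ t \<le> a" "a < 2 ^ Suc t"
  shows "xor a d < 2 ^ t"
proof -
  have "d > 0" using assms(1) by (metis less_le_trans zero_less_numeral zero_less_power)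
  then show ?thesis
    using xor_less_if_mem_bin_block[of a d] bin_block_upper[OF _ assms(1,2)]
      bin_log_eqI[OF assms(1,2)] assms by simp
qed

text \<open>The rejected value \<open>d\<close> and the first residue \<open>a\<close> both lie in
  the upper block, and each pair \<open>(d, a)\<close> amounts to constraints on two keys, which are
  distinct as \<open>t \<ge> 1\<close>. The \<open>(2 ^ Suc t - n) * 2 ^ t\<close> pairs together
  carry the rejection probability, after which the loop reads fresh keys.\<close>

lemma approx_prob_loop_upper:
  assumes t: "1 \<le> t" "Suc t \<le> q" and n: "2 ^ t < n" "n \<le> 2 ^ Suc t" and z: "2 ^ t \<le> z" "z < n"
  shows "approx_prob
    (\<lambda>x. n \<le> fliphash_pow2 h \<sigma> x (Suc t) \<and> fliphash_loop h \<sigma> x n (Suc t) [1..<m + 1] = z)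
    ((2 ^ Suc t - real n) / 2 ^ Suc t * exit_prob (Suc t) n z m)"
proof -
  define I where "I = {n..<2 ^ Suc t} \<times> {2 ^ t..<(2::nat) ^ Suc t}"
  define L where "L = (\<lambda>(d, a). [(\<sigma> (0, 0), residues (Suc t) {a}), (\<sigma> (t, 0), residues t {xor a d})])"
  let ?loop = "\<lambda>x. fliphash_loop h \<sigma> x n (Suc t) [1..<m + 1] = z"
  have "approx_prob (\<lambda>x. \<exists>i\<in>I. cylinder (L i) x \<and> ?loop x)
    (\<Sum>i\<in>I. 1 / 2 ^ Suc t / 2 ^ t * exit_prob (Suc t) n z m)"
  proof (rule approx_prob_Bex)
    fix i assume "i \<in> I"
    then obtain d a where i: "i = (d, a)" and da: "n \<le> d" "d < 2 ^ Suc t" "2 ^ t \<le> a" "a < 2 ^ Suc t"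
      by (auto simp: I_def)
    have "xor a d < 2 ^ t" using da n by (intro upper_xor_less) auto
    then have "weight (L i) = 1 / 2 ^ Suc t / 2 ^ t"
      using da t by (simp add: i L_def residues_density del: power_Suc)
    moreover have "approx_prob (\<lambda>x. cylinder (L i) x \<and> ?loop x)
        (weight (L i) * exit_prob (Suc t) n z (length [1..<m + 1]))"
    proof (rule approx_prob_loop)
      show "admissible (L i)"
        unfolding admissible_def using t residues_subset by (auto simp: i L_def k_eq \<sigma>_mem \<sigma>_eq_iff)
    qed (use t n z in \<open>auto simp: i L_def k_eq \<sigma>_eq_iff\<close>)
    ultimately show "approx_prob (\<lambda>x. cylinder (L i) x \<and> ?loop x)
        (1 / 2 ^ Suc t / 2 ^ t * exit_prob (Suc t) n z m)"
      by (simp only: length_upt add_diff_cancel_right')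
  next
    fix i j x assume ij: "i \<in> I" "j \<in> I" "x \<in> X"
      "cylinder (L i) x \<and> ?loop x" "cylinder (L j) x \<and> ?loop x"
    obtain d a d' a' where i: "i = (d, a)" "j = (d', a')" by (cases i, cases j)
    \<comment> \<open>The second constraint fixes \<open>xor a d\<close>; once \<open>a\<close> is
      known, cancellation gives \<open>d\<close>.\<close>
    have "a = a'" "xor a d = xor a' d'" using ij by (auto simp: i L_def residues_def)
    then show "i = j" unfolding i by (metis xor.assoc xor_self_eq xor.left_neutral)
  qed (simp add: I_def)
  also have "(\<Sum>i\<in>I. 1 / 2 ^ Suc t / 2 ^ t * exit_prob (Suc t) n z m) =
      (2 ^ Suc t - real n) / 2 ^ Suc t * exit_prob (Suc t) n z m"
    using n by (simp add: I_def card_cartesian_product of_nat_diff)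
  finally have *: "approx_prob (\<lambda>x. \<exists>i\<in>I. cylinder (L i) x \<and> ?loop x)
    ((2 ^ Suc t - real n) / 2 ^ Suc t * exit_prob (Suc t) n z m)" .
  have "(\<exists>i\<in>I. cylinder (L i) x \<and> ?loop x) \<longleftrightarrow> n \<le> fliphash_pow2 h \<sigma> x (Suc t) \<and> ?loop x"
    if x: "x \<in> X" for x
  proof -
    define A where "A = h x (\<sigma> (0, 0)) mod 2 ^ Suc t"
    have A: "A < 2 ^ Suc t" by (simp add: A_def)
    have "cylinder (L (d, a)) x \<longleftrightarrow> a = A \<and> fliphash_pow2 h \<sigma> x (Suc t) = d" if "(d, a) \<in> I" for d a
      using that x t n fliphash_pow2_upper_iff[of t d x]
      by (auto simp: I_def L_def hash_mem_residues_iff \<sigma>_mem A_def)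
    then have "(\<exists>i\<in>I. cylinder (L i) x) \<longleftrightarrow> (fliphash_pow2 h \<sigma> x (Suc t), A) \<in> I"
      by auto
    also have "\<dots> \<longleftrightarrow> n \<le> fliphash_pow2 h \<sigma> x (Suc t)"
      using fliphash_pow2_less[of h \<sigma> x "Suc t"] A n
        fliphash_pow2_upper_iff[of t "fliphash_pow2 h \<sigma> x (Suc t)" x]
      by (auto simp: I_def A_def)
    finally show ?thesis by auto
  qed
  then show ?thesis by (rule approx_prob_cong[OF *])
qed

text \<open>After rejection the top bit of the first residue is set, while its low bits drive the
  fallback \<open>fliphash_pow2 h \<sigma> x t\<close>. The rejected \<open>d\<close> is scrambled
  by the key \<open>\<sigma> (t, 0)\<close>, the fallback by \<open>\<sigma> (b, 0)\<close> with
  \<open>b < t\<close>, so in the ideal model the fallback stays uniform given rejection. These at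
  most three keys and the \<open>m\<close> loop keys exhaust the budget
  \<open>k = m + 3\<close>.\<close>

lemma approx_prob_loop_lower:
  assumes t: "1 \<le> t" "Suc t \<le> q" and n: "2 ^ t < n" "n \<le> 2 ^ Suc t" and z: "z < 2 ^ t"
  shows "approx_prob
    (\<lambda>x. n \<le> fliphash_pow2 h \<sigma> x (Suc t) \<and> fliphash_loop h \<sigma> x n (Suc t) [1..<m + 1] = z)
    ((2 ^ Suc t - real n) / 2 ^ Suc t / 2 ^ t * exit_prob (Suc t) n z m)"
proof -
  define b where "b = bin_log z"
  define I where "I = {n..<2 ^ Suc t} \<times> bin_block z"
  \<comment> \<open>The first residue is \<open>2 ^ t + a\<close> with low part \<open>a\<close>;
    the last constraint is dropped for \<open>b = 0\<close> for the same reason as in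
    \<open>approx_prob_pow2\<close>.\<close>
  define L where "L = (\<lambda>(d, a). [(\<sigma> (0, 0), residues (Suc t) {2 ^ t + a}),
    (\<sigma> (t, 0), residues t {xor (2 ^ t + a) d})] @
    (if b = 0 then [] else [(\<sigma> (b, 0), residues b {xor a z})]))"
  let ?loop = "\<lambda>x. fliphash_loop h \<sigma> x n (Suc t) [1..<m + 1] = z"
  have b: "b < t" using bin_log_less[OF z] t by (simp add: b_def)
  have a_less: "a < 2 ^ t" if "a \<in> bin_block z" for a using bin_block_subset[OF z] that by auto
  have xor: "xor a z < 2 ^ b" if "a \<in> bin_block z" for a
    using xor_less_if_mem_bin_block[OF that] by (simp add: b_def)
  have cyl: "cylinder (L (d, a)) x \<longleftrightarrow> h x (\<sigma> (0, 0)) mod 2 ^ Suc t = 2 ^ t + a \<and>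
      fliphash_pow2 h \<sigma> x (Suc t) = d \<and> fliphash_pow2 h \<sigma> x t = z"
    if x: "x \<in> X" and da: "(d, a) \<in> I" for d a x
  proof -
    define A where "A = h x (\<sigma> (0, 0)) mod 2 ^ Suc t"
    have da: "n \<le> d" "d < 2 ^ Suc t" "a \<in> bin_block z" using da by (auto simp: I_def)
    have "cylinder (L (d, a)) x \<longleftrightarrow> A = 2 ^ t + a \<and>
        h x (\<sigma> (t, 0)) mod 2 ^ t = xor (2 ^ t + a) d \<and> h x (\<sigma> (b, 0)) mod 2 ^ b = xor a z"
      using x t b xor[OF da(3)] by (auto simp: L_def hash_mem_residues_iff \<sigma>_mem A_def)
    moreover have "fliphash_pow2 h \<sigma> x (Suc t) = d \<longleftrightarrow> 2 ^ t \<le> A \<and> h x (\<sigma> (t, 0)) mod 2 ^ t = xor A d"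
      unfolding A_def using da n by (intro fliphash_pow2_upper_iff) auto
    moreover have "fliphash_pow2 h \<sigma> x t = z \<longleftrightarrow>
        A mod 2 ^ t \<in> bin_block z \<and> h x (\<sigma> (b, 0)) mod 2 ^ b = xor (A mod 2 ^ t) z"
    proof -
      \<comment> \<open>Both calls reduce the same hash, so passing from \<open>2 ^ Suc t\<close> to
        \<open>2 ^ t\<close> buckets only forgets the top bit.\<close>
      have "A mod 2 ^ t = h x (\<sigma> (0, 0)) mod 2 ^ t"
        unfolding A_def by (intro mod_mod_cancel) simp
      then show ?thesis by (simp add: fliphash_pow2_eq_iff b_def)
    qed
    ultimately show ?thesis using da(3) a_less[OF da(3)] by (auto simp: A_def)
  qed
  have "approx_prob (\<lambda>x. \<exists>i\<in>I. cylinder (L i) x \<and> ?loop x)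
    (\<Sum>i\<in>I. 1 / 2 ^ Suc t / 2 ^ t / 2 ^ b * exit_prob (Suc t) n z m)"
  proof (rule approx_prob_Bex)
    fix i assume "i \<in> I"
    then obtain d a where i: "i = (d, a)" and da: "n \<le> d" "d < 2 ^ Suc t" "a \<in> bin_block z"
      by (auto simp: I_def)
    have "xor (2 ^ t + a) d < 2 ^ t"
      using da n a_less[OF da(3)] by (intro upper_xor_less) auto
    moreover have "2 ^ t + a < 2 ^ Suc t" using a_less[OF da(3)] by simp
    ultimately have "weight (L i) = 1 / 2 ^ Suc t / 2 ^ t / 2 ^ b"
      using xor[OF da(3)] t b by (simp add: i L_def residues_density del: power_Suc)
    moreover have "approx_prob (\<lambda>x. cylinder (L i) x \<and> ?loop x)
        (weight (L i) * exit_prob (Suc t) n z (length [1..<m + 1]))"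
    proof (rule approx_prob_loop)
      show "admissible (L i)"
        unfolding admissible_def using t b residues_subset
        by (auto simp: i L_def k_eq \<sigma>_mem \<sigma>_eq_iff)
      show "fliphash_pow2 h \<sigma> x (Suc t - 1) = z" if "x \<in> X" "cylinder (L i) x" for x
        using that cyl[of x d a] \<open>i \<in> I\<close> i by simp
    qed (use t n z b in \<open>auto simp: i L_def k_eq \<sigma>_eq_iff\<close>)
    ultimately show "approx_prob (\<lambda>x. cylinder (L i) x \<and> ?loop x)
        (1 / 2 ^ Suc t / 2 ^ t / 2 ^ b * exit_prob (Suc t) n z m)"
      by (simp only: length_upt add_diff_cancel_right')
  next
    fix i j x assume ij: "i \<in> I" "j \<in> I" "x \<in> X"
      "cylinder (L i) x \<and> ?loop x" "cylinder (L j) x \<and> ?loop x"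
    obtain d a d' a' where i: "i = (d, a)" "j = (d', a')" by (cases i, cases j)
    then show "i = j" using ij cyl[of x d a] cyl[of x d' a'] by auto
  qed (simp add: I_def)
  \<comment> \<open>The \<open>2 ^ b\<close> elements of the block cancel \<open>1 / 2 ^ b\<close>,
    leaving the rejection probability times the fallback probability
    \<open>1 / 2 ^ t\<close>.\<close>
  also have "(\<Sum>i\<in>I. 1 / 2 ^ Suc t / 2 ^ t / 2 ^ b * exit_prob (Suc t) n z m) =
      (2 ^ Suc t - real n) / 2 ^ Suc t / 2 ^ t * exit_prob (Suc t) n z m"
    using n by (simp add: I_def card_cartesian_product of_nat_diff card_bin_block b_def)
  finally have *: "approx_prob (\<lambda>x. \<exists>i\<in>I. cylinder (L i) x \<and> ?loop x)
    ((2 ^ Suc t - real n) / 2 ^ Suc t / 2 ^ t * exit_prob (Suc t) n z m)" .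
  have "(\<exists>i\<in>I. cylinder (L i) x \<and> ?loop x) \<longleftrightarrow> n \<le> fliphash_pow2 h \<sigma> x (Suc t) \<and> ?loop x"
    if x: "x \<in> X" for x
  proof
    assume "\<exists>i\<in>I. cylinder (L i) x \<and> ?loop x"
    then obtain d a where "(d, a) \<in> I" "cylinder (L (d, a)) x" "?loop x" by auto
    then show "n \<le> fliphash_pow2 h \<sigma> x (Suc t) \<and> ?loop x"
      using cyl[OF x, of d a] by (auto simp: I_def)
  next
    assume H: "n \<le> fliphash_pow2 h \<sigma> x (Suc t) \<and> ?loop x"
    define A where "A = h x (\<sigma> (0, 0)) mod 2 ^ Suc t"
    define d where "d = fliphash_pow2 h \<sigma> x (Suc t)"
    have d: "n \<le> d" "d < 2 ^ Suc t" using H fliphash_pow2_less[of h \<sigma> x "Suc t"] by (auto simp: d_def)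
    \<comment> \<open>Every other exit of the loop returns at least \<open>2 ^ t\<close>, so the
      result \<open>z\<close> must be the fallback value.\<close>
    have z': "fliphash_pow2 h \<sigma> x t = z"
      using H z n fliphash_loop_eq_pow2[of "Suc t" n h \<sigma> x "[1..<m + 1]"] by simp
    have A: "2 ^ t \<le> A" "A < 2 ^ Suc t"
      using fliphash_pow2_upper_iff[of t d x] d n by (auto simp: A_def d_def)
    have "A mod 2 ^ t = h x (\<sigma> (0, 0)) mod 2 ^ t"
      unfolding A_def by (intro mod_mod_cancel) simp
    then have blk: "A mod 2 ^ t \<in> bin_block z" using z' by (simp add: fliphash_pow2_eq_iff)
    have "A mod 2 ^ t = A - 2 ^ t" using A by (simp add: mod_if)
    then have "A = 2 ^ t + A mod 2 ^ t" using A by simp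
    moreover have "(d, A mod 2 ^ t) \<in> I" using d blk by (simp add: I_def)
    ultimately show "\<exists>i\<in>I. cylinder (L i) x \<and> ?loop x"
      using cyl[OF x, of d "A mod 2 ^ t"] z' H by (intro bexI) (auto simp: A_def d_def)
  qed
  then show ?thesis by (rule approx_prob_cong[OF *])
qed

section \<open>Regularity of FlipHash\<close>

lemma approx_prob_fliphash:
  assumes n: "1 \<le> n" "n \<le> 2 ^ q" and z: "z < n"
  obtains p where "approx_prob (\<lambda>x. fliphash h \<sigma> m x n = z) p" "\<bar>p - 1 / n\<bar> \<le> 4 / 2 ^ k / n"
proof -
  define r where "r = nat \<lceil>log 2 (real n)\<rceil>"
  have "real n = 2 powr log 2 n" using n by simp
  also have "\<dots> \<le> 2 powr real r"
    unfolding r_def by (intro powr_mono real_nat_ceiling_ge) auto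
  finally have "real n \<le> 2 ^ r" by (simp add: powr_realpow)
  then have n_le: "n \<le> 2 ^ r" by (metis of_nat_le_iff of_nat_numeral of_nat_power)
  have "log 2 (real n) \<le> q"
    using n by (simp add: log_le_iff powr_realpow)
  then have r_le: "r \<le> q" by (simp add: r_def ceiling_le_iff nat_le_iff)
  have pow2: "approx_prob (\<lambda>x. fliphash_pow2 h \<sigma> x r = z) (1 / 2 ^ r)"
    using z n_le r_le by (intro approx_prob_pow2) auto
  have f: "fliphash h \<sigma> m x n = (if fliphash_pow2 h \<sigma> x r < n then fliphash_pow2 h \<sigma> x r
      else fliphash_loop h \<sigma> x n r [1..<m + 1])" for x
    by (simp add: fliphash_def r_def Let_def)
  show thesis
  proof (cases "n = 2 ^ r")
    case True
    then have "approx_prob (\<lambda>x. fliphash h \<sigma> m x n = z) (1 / 2 ^ r)"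
      using pow2 f fliphash_pow2_less[of h \<sigma> _ r] by simp
    then show thesis by (rule that) (simp add: True)
  next
    case False
    have "r \<noteq> 0" using False n_le n by (cases r) auto
    then obtain t where r: "r = Suc t" by (cases r) auto
    have "real t < log 2 (real n)" using r unfolding r_def by linarith
    then have "2 ^ t < real n" using n by (simp add: less_log_iff powr_realpow)
    then have t_less: "2 ^ t < n" by (metis of_nat_less_iff of_nat_numeral of_nat_power)
    \<comment> \<open>For \<open>t = 0\<close> the bounds would force \<open>n = 2 = 2 ^ r\<close>,
      the case already settled.\<close>
    have t: "1 \<le> t" using False n_le t_less r by (cases t) auto
    \<comment> \<open>In the ideal model \<open>u\<close> (below) is the rejection probability and
      \<open>w\<close> the probability that the loop then yields \<open>z\<close>; the factor
      \<open>1 / 2 ^ t\<close> accounts for the fallback being \<open>z\<close>.\<close>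
    define w where "w = (if z < 2 ^ t then 1 / 2 ^ t else 1) * exit_prob r n z m"
    define M :: real where "M = 2 ^ t"
    define u where "u = (2 * M - n) / (2 * M)"
    have M: "M > 0" "M < n" "n \<le> 2 * M"
      using \<open>2 ^ t < real n\<close> \<open>real n \<le> 2 ^ r\<close> by (auto simp: M_def r)
    have "approx_prob (\<lambda>x. n \<le> fliphash_pow2 h \<sigma> x r \<and>
        fliphash_loop h \<sigma> x n r [1..<m + 1] = z) (u * w)"
    proof (cases "z < 2 ^ t")
      case True
      then show ?thesis
        using approx_prob_loop_lower[OF t _ t_less _ True] r r_le n_le
        by (simp add: u_def w_def M_def)
    next
      case False
      then show ?thesis
        using approx_prob_loop_upper[OF t _ t_less _ _ z] r r_le n_le
        by (simp add: u_def w_def M_def)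
    qed
    with pow2 have "approx_prob (\<lambda>x. fliphash_pow2 h \<sigma> x r = z \<or>
        n \<le> fliphash_pow2 h \<sigma> x r \<and> fliphash_loop h \<sigma> x n r [1..<m + 1] = z) (1 / 2 ^ r + u * w)"
      by (rule approx_prob_disj) (use z in auto)
    then have 1: "approx_prob (\<lambda>x. fliphash h \<sigma> m x n = z) (1 / 2 ^ r + u * w)"
      by (rule approx_prob_cong) (use z f in auto)
    have u: "0 \<le> u" "u \<le> 1 / 2" using M by (auto simp: u_def field_simps)
    \<comment> \<open>Since \<open>u = 1 - n / (2 * M)\<close>, the main terms
      \<open>1 / (2 * M) + u / n\<close> equal \<open>1 / n\<close> exactly. What remains is
      \<open>u ^ (m + 1) / n\<close>, negated in the upper half and scaled by
      \<open>(n - M) / M\<close>, a number in \<open>[0, 1]\<close>, in the lower half.\<close>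
    have err: "\<bar>1 / 2 ^ r + u * w - 1 / n\<bar> \<le> u ^ (m + 1) / n"
    proof (cases "z < 2 ^ t")
      case True
      have w: "w = 1 / M * (M / n + (n - M) / n * u ^ m)"
        using True n by (simp add: w_def r exit_prob_closed_form u_def M_def)
      have "1 / 2 ^ r + u * w = 1 / (2 * M) + u / n + (n - M) / M * (u ^ (m + 1) / n)"
        unfolding w using M by (simp add: r field_simps flip: M_def)
      also have "1 / (2 * M) + u / n = 1 / n"
        using M by (simp add: u_def field_simps)
      finally have "1 / 2 ^ r + u * w - 1 / n = (n - M) / M * (u ^ (m + 1) / n)" by simp
      moreover have "(n - M) / M * (u ^ (m + 1) / n) \<le> 1 * (u ^ (m + 1) / n)"
        using M u by (intro mult_right_mono) auto
      moreover have "0 \<le> (n - M) / M * (u ^ (m + 1) / n)"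
        using M u by (intro mult_nonneg_nonneg) auto
      ultimately show ?thesis by simp
    next
      case False
      have w: "w = (1 - u ^ m) / n"
        using False n by (simp add: w_def r exit_prob_closed_form u_def M_def)
      have "1 / 2 ^ r + u * w = 1 / (2 * M) + u / n - u ^ (m + 1) / n"
        unfolding w using M by (simp add: r field_simps flip: M_def)
      also have "1 / (2 * M) + u / n = 1 / n"
        using M by (simp add: u_def field_simps)
      finally show ?thesis using u by simp
    qed
    \<comment> \<open>The bound \<open>u \<le> 1 / 2\<close> comes from \<open>M < n\<close>; the
      constant 4 comes from \<open>m + 1 = k - 2\<close>.\<close>
    have "u ^ (m + 1) \<le> (1 / 2) ^ (m + 1)" using u by (intro power_mono)
    also have "\<dots> = 4 / 2 ^ k" by (simp add: k_eq power_add power_divide)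
    finally have "u ^ (m + 1) / n \<le> 4 / 2 ^ k / n" by (intro divide_right_mono) auto
    with err show thesis by (intro that[OF 1]) linarith
  qed
qed

lemma fliphash_regular:
  assumes "1 \<le> n" "n \<le> 2 ^ q" "z < n"
  shows "\<bar>measure_pmf.prob (pmf_of_set X) {x. fliphash h \<sigma> m x n = z} - 1 / n\<bar>
    \<le> (2 * \<epsilon> + 4 / 2 ^ k) / n"
proof -
  obtain p where p: "approx_prob (\<lambda>x. fliphash h \<sigma> m x n = z) p" "\<bar>p - 1 / n\<bar> \<le> 4 / 2 ^ k / n"
    using approx_prob_fliphash[OF assms] .
  let ?P = "measure_pmf.prob (pmf_of_set X) {x. fliphash h \<sigma> m x n = z}"
  have "\<bar>?P - p\<bar> \<le> \<epsilon> * p"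
    using p(1) by (auto simp: approx_prob_def rel_approx_def abs_le_iff algebra_simps)
  \<comment> \<open>As \<open>4 / 2 ^ k \<le> 1\<close>, the ideal probability is at most twice
    \<open>1 / n\<close>; this turns the relative error into an additive one.\<close>
  also have "\<epsilon> * p \<le> \<epsilon> * (2 / n)"
  proof (rule mult_left_mono[OF _ eps_nonneg])
    have "2 \<le> k" by (simp add: k_eq)
    then have "(2::real) ^ 2 \<le> 2 ^ k" by (intro power_increasing) auto
    then have "(4::real) / 2 ^ k \<le> 1" by simp
    then have "4 / 2 ^ k / real n \<le> 1 / n" by (intro divide_right_mono) auto
    moreover have "2 / real n = 1 / n + 1 / n" by simp
    ultimately show "p \<le> 2 / n" using p(2) by linarith
  qed
  finally have "\<bar>?P - p\<bar> \<le> 2 * \<epsilon> / n" by (simp add: mult_ac)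
  then show ?thesis using p(2) unfolding add_divide_distrib by linarith
qed

end

section \<open>The absolute constant\<close>

theorem theorem2p5:
  shows "\<exists>C::real. C > 0 \<and>
    (\<forall>(X :: 'x set) (S :: 's set) (q :: nat) (\<epsilon> :: real) (k :: nat)
       (h :: 'x \<Rightarrow> 's \<Rightarrow> nat) (\<sigma> :: nat \<times> nat \<Rightarrow> 's) (m :: nat).
       finite X \<and> X \<noteq> {} \<and> q \<ge> 1 \<and> 0 \<le> \<epsilon> \<and> \<epsilon> < 1 \<and> k \<ge> 3 \<and>
       (q = 1 \<longrightarrow> infinite S \<or> k \<le> card S) \<and>
       (\<forall>x\<in>X. h x \<in> S \<rightarrow> {..<2 ^ q}) \<and>
       k_wise_independent \<epsilon> k q X S h \<and>
       m = k - 3 \<and>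
       \<sigma> \<in> {0..q - 1} \<times> {0..m} \<rightarrow> S \<and>
       inj_on \<sigma> ({0..q - 1} \<times> {0..m}) \<longrightarrow>
       (\<forall>n\<in>{1..2 ^ q}. \<forall>z\<in>{..<n}.
          \<bar>measure_pmf.prob (pmf_of_set X) {x. fliphash h \<sigma> m x n = z} - 1 / real n\<bar>
            \<le> C * (\<epsilon> + 1 / 2 ^ k) / real n))"
proof (intro exI[of _ 32] conjI allI impI ballI)
  fix X :: "'x set" and S :: "'s set" and q :: nat and \<epsilon> :: real and k :: nat
    and h :: "'x \<Rightarrow> 's \<Rightarrow> nat" and \<sigma> :: "nat \<times> nat \<Rightarrow> 's" and m n z :: nat
  assume H: "finite X \<and> X \<noteq> {} \<and> q \<ge> 1 \<and> 0 \<le> \<epsilon> \<and> \<epsilon> < 1 \<and> k \<ge> 3 \<and>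
       (q = 1 \<longrightarrow> infinite S \<or> k \<le> card S) \<and>
       (\<forall>x\<in>X. h x \<in> S \<rightarrow> {..<2 ^ q}) \<and>
       k_wise_independent \<epsilon> k q X S h \<and>
       m = k - 3 \<and>
       \<sigma> \<in> {0..q - 1} \<times> {0..m} \<rightarrow> S \<and>
       inj_on \<sigma> ({0..q - 1} \<times> {0..m})"
    and n: "n \<in> {1..2 ^ q}" and z: "z \<in> {..<n}"
  let ?P = "measure_pmf.prob (pmf_of_set X) {x. fliphash h \<sigma> m x n = z}"
  \<comment> \<open>With enough keys the constant 4 would do. The value 32 is set by the remaining
    case \<open>k = 3\<close>, \<open>n \<le> 4\<close>, where \<open>32 / 2 ^ 3 / 4 = 1\<close>
    bounds any difference of two numbers in \<open>[0, 1]\<close>.\<close>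
  show "\<bar>?P - 1 / real n\<bar> \<le> 32 * (\<epsilon> + 1 / 2 ^ k) / real n"
  proof (cases "infinite S \<or> k \<le> card S")
    case True
    then interpret fliphash_family \<epsilon> k q X S h \<sigma> m
      using H by unfold_locales auto
    have "\<bar>?P - 1 / real n\<bar> \<le> (2 * \<epsilon> + 4 / 2 ^ k) / n"
      using n z by (intro fliphash_regular) auto
    also have "\<dots> \<le> 32 * (\<epsilon> + 1 / 2 ^ k) / n"
    proof (rule divide_right_mono)
      have "32 * (\<epsilon> + 1 / 2 ^ k) = 2 * \<epsilon> + 4 / 2 ^ k + (30 * \<epsilon> + 28 / 2 ^ k)" by simp
      moreover have "0 \<le> 30 * \<epsilon> + 28 / 2 ^ k" using eps_nonneg by simp
      ultimately show "2 * \<epsilon> + 4 / 2 ^ k \<le> 32 * (\<epsilon> + 1 / 2 ^ k)" by linarith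
    qed simp
    finally show ?thesis .
  next
    case False
    \<comment> \<open>The keys \<open>\<sigma> (i, j)\<close> number \<open>q * (k - 2)\<close>, so that \<open>q = 2\<close> and \<open>k = 3\<close>. Independence is then
      vacuous, but \<open>n \<le> 4\<close> makes the bound trivial.\<close>
    have "card ({0..q - 1} \<times> {0..m}) \<le> card S"
      using H False by (intro card_inj_on_le[of \<sigma>]) auto
    then have "q * (m + 1) < m + 3" using H False by (simp add: card_cartesian_product)
    moreover have "q \<ge> 2" using H False by (cases "q = 1") auto
    ultimately have "q < 3" "m = 0"
    proof -
      have "2 * (m + 1) \<le> q * (m + 1)" using \<open>q \<ge> 2\<close> by (rule mult_le_mono1)
      then show "m = 0" using \<open>q * (m + 1) < m + 3\<close> by simp
      then show "q < 3" using \<open>q * (m + 1) < m + 3\<close> by simp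
    qed
    then have "q = 2" "k = 3" using H \<open>q \<ge> 2\<close> by auto
    then have "real n \<ge> 1" "real n \<le> 4" using n by auto
    have "\<bar>?P - 1 / real n\<bar> \<le> 1"
      using \<open>real n \<ge> 1\<close> measure_pmf.prob_le_1[of "pmf_of_set X" "{x. fliphash h \<sigma> m x n = z}"]
        measure_nonneg[of "pmf_of_set X" "{x. fliphash h \<sigma> m x n = z}"] divide_le_eq_1[of 1 "real n"]
      by (smt (verit) divide_nonneg_nonneg)
    also have "1 \<le> 32 * (\<epsilon> + 1 / 2 ^ k) / real n"
      using \<open>real n \<ge> 1\<close> \<open>real n \<le> 4\<close> H \<open>k = 3\<close> by (simp add: le_divide_eq)
    finally show ?thesis .
  qed
qed simp

end
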